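(* Let $\Omega\supseteq\mathbb{D}$ be a simply connected domain, let $\lambda=\lambda(\Omega)$ be as defined below, and let $f\in\mathcal{B}(\Omega)$ with $f(z)=\sum_{n=0}^\infty a_n z^n$ for $z\in\mathbb{D}$. For $0<r<1$ let $S_r$ denote the area of the image $f(\mathbb{D}(0;r))$. Then $$\sum_{n=0}^\infty |a_n| r^n+2\left(\frac{1+\lambda}{1+2\lambda}\right)^2\frac{S_r}{\pi}\le 1\qquad\text{for all } 0\le r\le\frac{1}{1+2\lambda}.$$
   Context: $\mathbb{D}(a;r)=\{z:|z-a|<r\}$, $\mathbb{D}=\mathbb{D}(0;1)$. For a simply connected domain $\Omega\supseteq\mathbb{D}$, $\mathcal{B}(\Omega)$ is the class of functions analytic on $\Omega$ with $f(\Omega)\subseteq\overline{\mathbb{D}}$, and $$\lambda(\Omega)=\sup\left\{\frac{|a_n|}{1-|a_0|^2}:\ n\ge1,\ f\in\mathcal{B}(\Omega)\text{ nonconstant},\ f(z)=\sum_{k=0}^\infty a_k z^k \text{ on }\mathbb{D}\right\}.$$ *)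

theory Defs
  imports "HOL-Complex_Analysis.Complex_Analysis"
begin

definition bclass :: "complex set \<Rightarrow> (complex \<Rightarrow> complex) set" where
  "bclass \<Omega> = {f. f holomorphic_on \<Omega> \<and> f ` \<Omega> \<subseteq> cball 0 1}"

definition bohr_lambda :: "complex set \<Rightarrow> real" where
  "bohr_lambda \<Omega> = Sup {norm (a n) / (1 - (norm (a 0))\<^sup>2) | n a f.
      n \<ge> 1 \<and> f \<in> bclass \<Omega> \<and> \<not> (\<exists>c. \<forall>z\<in>\<Omega>. f z = c) \<and>
      (\<forall>z\<in>ball 0 1. (\<lambda>k. a k * z ^ k) sums f z)}"

end

theory Submission
  imports Defs
begin

text \<open>
  Parseval's identity on circles, applied to \<open>f(z) (1 + t (z/\<bar>z\<bar>)\<^sup>n)\<close>, gives Wiener's bound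
  \<open>\<bar>a\<^sub>n\<bar> \<le> 1 - \<bar>a\<^sub>0\<bar>\<^sup>2\<close>; hence the supremum defining \<open>\<lambda>\<close> is finite and
  \<open>\<bar>a\<^sub>n\<bar> \<le> M = \<lambda> (1 - \<bar>a\<^sub>0\<bar>\<^sup>2)\<close> for \<open>n \<ge> 1\<close>. The area of \<open>f(D(0;r))\<close> is at most the integral of
  \<open>\<bar>f'\<bar>\<^sup>2\<close>, so Parseval for \<open>f'\<close> bounds it by \<open>\<pi> M\<^sup>2 r\<^sup>2/(1 - r\<^sup>2)\<^sup>2\<close>. For \<open>r \<le> 1/(1 + 2\<lambda>)\<close> and
  \<open>A = \<bar>a\<^sub>0\<bar>\<close> the left-hand side is therefore at most
  \<open>A + (1 - A\<^sup>2)/2 + (1 - A\<^sup>2)\<^sup>2/8 \<le> 1\<close>.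
\<close>

unbundle no fps_syntax

section \<open>Lebesgue measure and iterated integrals in the plane\<close>

text \<open>Lebesgue measure is determined by its values on boxes, and the coordinate map pulls a
  box back to a box with the same side lengths.\<close>

lemma lborel_distr_cart2_complex:
  "distr lborel borel (\<lambda>v::real^2. Complex (v $ 1) (v $ 2)) = lborel"
proof (rule sym, rule lborel_eqI)
  fix l u :: complex
  assume le: "\<And>b. b \<in> Basis \<Longrightarrow> l \<bullet> b \<le> u \<bullet> b"
  have le': "Re l \<le> Re u" "Im l \<le> Im u"
    using le[of 1] le[of \<i>] by (auto simp: Basis_complex_def)
  have meas: "(\<lambda>v::real^2. Complex (v $ 1) (v $ 2)) \<in> borel_measurable lborel"
    unfolding Complex_eq
    by (auto intro!: borel_measurable_continuous_onI continuous_intros)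
  have pre: "(\<lambda>v::real^2. Complex (v $ 1) (v $ 2)) -` box l u
    = box (vector [Re l, Im l]) (vector [Re u, Im u])"
    by (auto simp: in_box_complex_iff mem_box_cart forall_2)
  have "emeasure (distr lborel borel (\<lambda>v::real^2. Complex (v $ 1) (v $ 2))) (box l u)
      = emeasure lborel (box (vector [Re l, Im l] :: real^2) (vector [Re u, Im u]))"
    using meas by (simp add: emeasure_distr pre)
  also have "\<dots> = ennreal (\<Prod>b\<in>Basis. (vector [Re u, Im u] - vector [Re l, Im l] :: real^2) \<bullet> b)"
  proof (rule emeasure_lborel_box)
    fix b :: "real^2" assume "b \<in> Basis"
    then obtain i where "b = axis i 1" by (auto simp: Basis_vec_def)
    with le' exhaust_2[of i] show "vector [Re l, Im l] \<bullet> b \<le> vector [Re u, Im u] \<bullet> b"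
      by (auto simp: inner_axis)
  qed
  also have "(\<Prod>b\<in>Basis. (vector [Re u, Im u] - vector [Re l, Im l] :: real^2) \<bullet> b)
      = (Re u - Re l) * (Im u - Im l)"
    by (simp add: Basis_vec_def cart_eq_inner_axis[symmetric] axis_eq_axis prod.UNION_disjoint prod_2 UNIV_2)
  also have "\<dots> = (\<Prod>b\<in>Basis. (u - l) \<bullet> b)"
    by (simp add: Basis_complex_def)
  finally show "emeasure (distr lborel borel (\<lambda>v::real^2. Complex (v $ 1) (v $ 2))) (box l u)
    = ennreal (\<Prod>b\<in>Basis. (u - l) \<bullet> b)" .
qed simp

text \<open>The area bound \<open>measure_differentiable_image\<close> concerns subsets of
  \<open>real^'n\<close>; this carries it over to \<open>complex\<close>.\<close>

lemma measure_complex_eq_cart2: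
  fixes K :: "complex set"
  assumes "K \<in> sets borel"
  shows "measure lebesgue K = measure lebesgue ((\<lambda>z. vector [Re z, Im z] :: real^2) ` K)"
proof -
  let ?g = "\<lambda>v::real^2. Complex (v $ 1) (v $ 2)"
  have meas: "?g \<in> borel_measurable lborel"
    unfolding Complex_eq
    by (auto intro!: borel_measurable_continuous_onI continuous_intros)
  have pre: "(\<lambda>z. vector [Re z, Im z] :: real^2) ` K = ?g -` K"
    by (force simp: vec_eq_iff forall_2 image_iff)
  have "?g -` K \<in> sets borel"
    using measurable_sets[OF meas assms] by simp
  then show ?thesis
    using assms meas unfolding pre
    by (simp add: measure_def emeasure_distr flip: lborel_distr_cart2_complex)
qed

lemma vector_2_eq_axis: "(vector [x, y] :: real^2) = x *\<^sub>R axis 1 1 + y *\<^sub>R axis 2 1"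
  by (simp add: vec_eq_iff forall_2 axis_def)

text \<open>The coordinate bijection preserves the content of boxes, so
  \<open>has_integral_twiddle\<close> with factor 1 moves the integral to pairs of reals, where
  Fubini for continuous functions applies.\<close>

lemma integral_cart2_eq_iterated:
  fixes F :: "real \<times> real \<Rightarrow> 'a::banach"
  assumes cont: "continuous_on (cbox (a, c) (b, d)) F"
  shows "integral (cbox (vector [a, c] :: real^2) (vector [b, d])) (\<lambda>v. F (v $ 1, v $ 2))
    = integral {a..b} (\<lambda>x. integral {c..d} (\<lambda>y. F (x, y)))"
proof -
  let ?g = "\<lambda>p::real\<times>real. vector [fst p, snd p] :: real^2"
  let ?h = "\<lambda>v::real^2. (v $ 1, v $ 2)"
  have gh: "?g (?h x) = x" for x by (simp add: vec_eq_iff forall_2)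
  have mem: "?g p \<in> cbox (?g u) (?g v) \<longleftrightarrow> p \<in> cbox u v" for p u v
    by (cases p; cases u; cases v) (simp add: mem_box_cart forall_2 cbox_Pair_eq)
  have img_g: "?g ` cbox u v = cbox (?g u) (?g v)" for u v
  proof (rule set_eqI)
    fix x
    show "x \<in> ?g ` cbox u v \<longleftrightarrow> x \<in> cbox (?g u) (?g v)"
      using mem gh by (metis (no_types, lifting) image_iff)
  qed
  have img_h: "?h ` cbox u v = cbox (?h u) (?h v)" for u v
  proof -
    have "cbox u v = ?g ` cbox (?h u) (?h v)" using gh by (simp add: img_g)
    then show ?thesis by (simp add: image_image)
  qed
  have contv: "continuous_on (cbox (vector [a, c] :: real^2) (vector [b, d])) (\<lambda>v. F (?h v))"
    by (rule continuous_on_compose2[OF cont])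
      (auto intro!: continuous_intros simp: mem_box_cart forall_2 mem_box Basis_prod_def)
  then have int: "((\<lambda>v. F (?h v)) has_integral integral (cbox (vector [a, c]) (vector [b, d])) (\<lambda>v. F (?h v)))
     (cbox (vector [a, c] :: real^2) (vector [b, d]))"
    using integrable_continuous integrable_integral by blast
  have ex2: "(\<exists>i::2. P i) \<longleftrightarrow> P 1 \<or> P 2" for P
    using forall_2[of "\<lambda>i. \<not> P i"] by blast
  have "((\<lambda>p. F (?h (?g p))) has_integral (1 / 1) *\<^sub>R integral (cbox (vector [a, c]) (vector [b, d])) (\<lambda>v. F (?h v)))
     (?h ` cbox (vector [a, c] :: real^2) (vector [b, d]))"
  proof (rule has_integral_twiddle[OF _ _ _ _ _ _ _ int])
    show "measure lborel (?g ` cbox u v) = 1 * measure lborel (cbox u v)" for u v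
      by (cases u; cases v)
        (simp add: img_g content_cbox_if_cart content_Pair content_real_if UNIV_2
          interval_eq_empty_cart not_less ex2)
    show "isCont ?g p" for p
      unfolding vector_2_eq_axis by (intro continuous_intros)
  qed (use img_g img_h gh in auto)
  then have "(F has_integral integral (cbox (vector [a, c]) (vector [b, d])) (\<lambda>v. F (?h v))) (cbox (a, c) (b, d))"
    by (simp add: img_h)
  then show ?thesis
    using integral_prod_continuous[OF cont] by (simp add: integral_unique cbox_interval)
qed

section \<open>Parseval's identity for absolutely convergent Fourier series\<close>

lemma has_integral_cis_int:
  fixes m :: int
  shows "((\<lambda>t. cis (m * t)) has_integral (if m = 0 then 2 * pi else 0)) {0..2 * pi}"
proof (cases "m = 0")
  case True
  then show ?thesis
    using has_integral_const_real[of "1::complex" 0 "2 * pi"] by (simp add: scaleR_conv_of_real)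
next
  case False
  let ?F = "\<lambda>z. exp (\<i> * m * z) / (\<i> * m)"
  have "(?F has_field_derivative exp (\<i> * m * z)) (at z)" for z :: complex
    using False by (auto intro!: derivative_eq_intros)
  then have "((\<lambda>t. ?F (complex_of_real t)) has_vector_derivative cis (m * t)) (at t within {0..2 * pi})" for t :: real
    using has_vector_derivative_real_field[of ?F] by (force simp: cis_conv_exp mult_ac)
  then have "((\<lambda>t. cis (m * t)) has_integral ?F (complex_of_real (2 * pi)) - ?F (complex_of_real 0)) {0..2 * pi}"
    by (intro fundamental_theorem_of_calculus) auto
  then have "((\<lambda>t. cis (m * t)) has_integral
      cis (m * (2 * pi)) / (\<i> * m) - 1 / (\<i> * m)) {0..2 * pi}"
    by (simp add: cis_conv_exp mult_ac)
  moreover have "cis (m * (2 * pi)) = 1"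
    using cis_multiple_2pi[of "real_of_int m"] by (simp add: mult_ac)
  ultimately show ?thesis using False by simp
qed

text \<open>Expanding the square as z times its conjugate gives a double sum, of which
  \<open>has_integral_cis_int\<close> leaves only the diagonal.\<close>

lemma has_integral_norm_trig_poly_squared:
  fixes c :: "nat \<Rightarrow> complex"
  shows "((\<lambda>t. (norm (\<Sum>k<N. c k * cis (k * t)))\<^sup>2) has_integral 2 * pi * (\<Sum>k<N. (norm (c k))\<^sup>2)) {0..2 * pi}"
proof -
  have sq: "(complex_of_real (norm z))\<^sup>2 = z * cnj z" for z
    by (metis complex_norm_square of_real_power)
  have eq: "complex_of_real ((norm (\<Sum>k<N. c k * cis (k * t)))\<^sup>2)
      = (\<Sum>j<N. \<Sum>k<N. c j * cnj (c k) * cis (of_int (int j - int k) * t))" for t :: real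
    by (simp only: complex_norm_square)
      (simp add: sum_product cis_cnj cis_mult algebra_simps)
  have "((\<lambda>t. \<Sum>j<N. \<Sum>k<N. c j * cnj (c k) * cis (of_int (int j - int k) * t)) has_integral
      (\<Sum>j<N. \<Sum>k<N. c j * cnj (c k) * (if int j - int k = 0 then 2 * pi else 0))) {0..2 * pi}"
    by (intro has_integral_sum has_integral_mult_right has_integral_cis_int finite_lessThan)
  also have "(\<Sum>j<N. \<Sum>k<N. c j * cnj (c k) * (if int j - int k = 0 then 2 * pi else 0))
      = complex_of_real (2 * pi * (\<Sum>k<N. (norm (c k))\<^sup>2))"
    by (simp add: if_distrib sq sum_distrib_left mult_ac cong: if_cong)
  finally have "((\<lambda>t. complex_of_real ((norm (\<Sum>k<N. c k * cis (k * t)))\<^sup>2)) has_integral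
      complex_of_real (2 * pi * (\<Sum>k<N. (norm (c k))\<^sup>2))) {0..2 * pi}"
    by (simp only: eq)
  from has_integral_Re[OF this] show ?thesis by simp
qed

lemma summable_norm_squared:
  fixes c :: "nat \<Rightarrow> 'a::real_normed_vector"
  assumes sm: "summable (\<lambda>k. norm (c k))"
  shows "summable (\<lambda>k. (norm (c k))\<^sup>2)"
proof (rule summable_comparison_test'[OF summable_mult[OF sm, of "\<Sum>k. norm (c k)"]])
  fix k
  have "norm (c k) \<le> (\<Sum>k. norm (c k))"
    using sum_le_suminf[OF sm, of "{k}"] by simp
  then show "norm ((norm (c k))\<^sup>2) \<le> (\<Sum>k. norm (c k)) * norm (c k)"
    by (simp add: power2_eq_square mult_right_mono)
qed

text \<open>Dominated convergence from the trigonometric polynomials: all partial sums are bounded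
  by the sum of the \<open>norm (c k)\<close>, and a constant is integrable on the circle.\<close>

lemma parseval_cis_series:
  fixes c :: "nat \<Rightarrow> complex"
  assumes sm: "summable (\<lambda>k. norm (c k))"
  shows "((\<lambda>t. (norm (\<Sum>k. c k * cis (k * t)))\<^sup>2) has_integral 2 * pi * (\<Sum>k. (norm (c k))\<^sup>2)) {0..2 * pi}"
proof -
  let ?f = "\<lambda>N (t::real). (norm (\<Sum>k<N. c k * cis (k * t)))\<^sup>2"
  let ?g = "\<lambda>t::real. (norm (\<Sum>k. c k * cis (k * t)))\<^sup>2"
  have int: "?f N integrable_on {0..2 * pi}" for N
    using has_integral_norm_trig_poly_squared by blast
  have bound: "norm (?f N t) \<le> (\<Sum>k. norm (c k))\<^sup>2" for N t
  proof -
    have "norm (\<Sum>k<N. c k * cis (k * t)) \<le> (\<Sum>k<N. norm (c k))"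
      by (rule sum_norm_le) (simp add: norm_mult)
    also have "\<dots> \<le> (\<Sum>k. norm (c k))"
      using sm by (intro sum_le_suminf) auto
    finally show ?thesis by (simp add: power_mono)
  qed
  have conv: "(\<lambda>N. ?f N t) \<longlonglongrightarrow> ?g t" for t
  proof -
    have "summable (\<lambda>k. c k * cis (k * t))"
      by (rule summable_norm_cancel) (use sm in \<open>simp add: norm_mult\<close>)
    then show ?thesis
      by (rule tendsto_power[OF tendsto_norm[OF summable_LIMSEQ]])
  qed
  have "?g integrable_on {0..2 * pi}"
    and lim: "(\<lambda>N. integral {0..2 * pi} (?f N)) \<longlonglongrightarrow> integral {0..2 * pi} ?g"
    using dominated_convergence[of ?f "{0..2 * pi}" "\<lambda>_. (\<Sum>k. norm (c k))\<^sup>2" ?g] int bound conv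
    by auto
  have "(\<lambda>N. 2 * pi * (\<Sum>k<N. (norm (c k))\<^sup>2)) \<longlonglongrightarrow> 2 * pi * (\<Sum>k. (norm (c k))\<^sup>2)"
    by (rule tendsto_mult_left[OF summable_LIMSEQ[OF summable_norm_squared[OF sm]]])
  moreover have int_eq: "integral {0..2 * pi} (?f N) = 2 * pi * (\<Sum>k<N. (norm (c k))\<^sup>2)" for N
    using has_integral_norm_trig_poly_squared by (rule integral_unique)
  ultimately have "integral {0..2 * pi} ?g = 2 * pi * (\<Sum>k. (norm (c k))\<^sup>2)"
    using LIMSEQ_unique[OF lim[unfolded int_eq]] by blast
  then show ?thesis
    using \<open>?g integrable_on _\<close> by (simp add: has_integral_iff)
qed

section \<open>Coefficient bounds for functions bounded by 1 on the disc\<close>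

text \<open>
  Parseval on a circle of radius \<open>\<rho>\<close> for \<open>f(z) (1 + t e\<^sup>i\<^sup>n\<^sup>\<theta>)\<close>, whose
  modulus is at most that of the second factor, and then the limit \<open>\<rho> \<rightarrow> 1\<close>.
\<close>
lemma coeff_inequality_unit_bound:
  fixes a :: "nat \<Rightarrow> complex"
  assumes sums: "\<And>z. z \<in> ball 0 1 \<Longrightarrow> (\<lambda>k. a k * z ^ k) sums f z"
    and bound: "\<And>z. z \<in> ball 0 1 \<Longrightarrow> norm (f z) \<le> 1"
    and n: "n \<ge> 1"
  shows "(norm (a 0))\<^sup>2 + (norm (a n + t * a 0))\<^sup>2 \<le> 1 + (norm t)\<^sup>2"
proof -
  have main: "(norm (a 0))\<^sup>2 + (norm (a n * of_real \<rho> ^ n + t * a 0))\<^sup>2 \<le> 1 + (norm t)\<^sup>2"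
    if \<rho>: "0 < \<rho>" "\<rho> < 1" for \<rho> :: real
  proof -
    \<comment> \<open>Fourier coefficients in x: \<open>b\<close> of f(\<rho> cis x),
      \<open>s\<close> of its product with t cis(n x), which shifts indices by \<open>n\<close>, and
      \<open>e\<close> of the majorant 1 + t cis(n x).\<close>
    define b where "b k = a k * \<rho> ^ k" for k
    define s where "s k = (if k < n then 0 else t * b (k - n))" for k
    define e where "e k = (if k = 0 then 1 else if k = n then t else 0)" for k
    have sm_b: "summable (\<lambda>k. norm (b k))"
      \<comment> \<open>The midpoint of \<rho> and 1 is still inside the disc, and convergence there
        implies absolute convergence at \<rho>.\<close>
      using powser_insidea[OF sums_summable[OF sums], of "of_real ((1 + \<rho>) / 2)" "of_real \<rho>"] \<rho>
      by (simp add: b_def norm_mult norm_power norm_divide del: of_real_divide of_real_add)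
    have "summable (\<lambda>k. norm (s (k + n)))"
      using summable_mult[OF sm_b, of "norm t"] by (simp add: s_def norm_mult)
    then have sm_s: "summable (\<lambda>k. norm (s k))"
      by (subst (asm) summable_iff_shift)
    have sm: "summable (\<lambda>k. norm (b k + s k))"
      by (rule summable_comparison_test'[OF summable_add[OF sm_b sm_s]]) (simp add: norm_triangle_ineq)
    have sm_e: "summable (\<lambda>k. norm (e k))"
      by (rule summable_finite[of "{0, n}"]) (auto simp: e_def)
    have val_e: "(\<Sum>k. e k * cis (k * x)) = 1 + t * cis (n * x)" for x :: real
      using n by (subst suminf_finite[of "{0, n}"]) (auto simp: e_def)
    have val: "(\<Sum>k. (b k + s k) * cis (k * x)) = f (\<rho> * cis x) * (1 + t * cis (n * x))" for x :: real
    proof (rule sums_unique[symmetric])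
      have "(\<lambda>k. a k * (\<rho> * cis x) ^ k) sums f (\<rho> * cis x)"
        using \<rho> by (intro sums) (simp add: norm_mult)
      then have 1: "(\<lambda>k. b k * cis (k * x)) sums f (\<rho> * cis x)"
        by (simp add: b_def power_mult_distrib Complex.DeMoivre mult_ac)
      have "s (k + n) * cis (real (k + n) * x) = b k * cis (k * x) * (t * cis (n * x))" for k
        by (simp add: s_def distrib_right flip: cis_mult)
      then have "(\<lambda>k. s (k + n) * cis (real (k + n) * x)) sums (f (\<rho> * cis x) * (t * cis (n * x)))"
        using sums_mult2[OF 1, of "t * cis (n * x)"] by presburger
      then have 2: "(\<lambda>k. s k * cis (k * x)) sums (f (\<rho> * cis x) * (t * cis (n * x)))"
        using sums_zero_iff_shift[of n "\<lambda>k. s k * cis (k * x)"] by (simp add: s_def)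
      show "(\<lambda>k. (b k + s k) * cis (k * x)) sums (f (\<rho> * cis x) * (1 + t * cis (n * x)))"
        using sums_add[OF 1 2] by (simp add: algebra_simps)
    qed
    have "2 * pi * (\<Sum>k. (norm (b k + s k))\<^sup>2) \<le> 2 * pi * (\<Sum>k. (norm (e k))\<^sup>2)"
    proof (rule has_integral_le[OF parseval_cis_series[OF sm] parseval_cis_series[OF sm_e]])
      fix x :: real
      have "norm (f (\<rho> * cis x)) \<le> 1"
        using \<rho> by (intro bound) (simp add: norm_mult)
      then show "(norm (\<Sum>k. (b k + s k) * cis (k * x)))\<^sup>2 \<le> (norm (\<Sum>k. e k * cis (k * x)))\<^sup>2"
        unfolding val val_e norm_mult
        by (intro power_mono mult_left_le_one_le) auto
    qed
    then have "(\<Sum>k. (norm (b k + s k))\<^sup>2) \<le> (\<Sum>k. (norm (e k))\<^sup>2)"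
      by simp
    also have "\<dots> = 1 + (norm t)\<^sup>2"
      using n by (subst suminf_finite[of "{0, n}"]) (auto simp: e_def)
    finally have "(\<Sum>k. (norm (b k + s k))\<^sup>2) \<le> 1 + (norm t)\<^sup>2" .
    \<comment> \<open>Only the coefficients 0 and \<open>n\<close> are kept; since
      \<open>n \<ge> 1\<close>, \<open>s 0 = 0\<close> and \<open>s n = t * b 0\<close>.\<close>
    moreover have "(\<Sum>k\<in>{0, n}. (norm (b k + s k))\<^sup>2) \<le> (\<Sum>k. (norm (b k + s k))\<^sup>2)"
      by (rule sum_le_suminf[OF summable_norm_squared[OF sm]]) auto
    ultimately show ?thesis
      using n by (simp add: s_def b_def)
  qed
  have "((\<lambda>\<rho>::real. (norm (a 0))\<^sup>2 + (norm (a n * of_real \<rho> ^ n + t * a 0))\<^sup>2) \<longlongrightarrow>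
      (norm (a 0))\<^sup>2 + (norm (a n * of_real 1 ^ n + t * a 0))\<^sup>2) (at_left 1)"
    by (intro tendsto_intros)
  moreover have "eventually (\<lambda>\<rho>::real. (norm (a 0))\<^sup>2 + (norm (a n * of_real \<rho> ^ n + t * a 0))\<^sup>2 \<le> 1 + (norm t)\<^sup>2) (at_left 1)"
    using eventually_at_left_real[of 0 "1::real"] by (auto elim!: eventually_mono intro!: main)
  ultimately have "(norm (a 0))\<^sup>2 + (norm (a n * of_real 1 ^ n + t * a 0))\<^sup>2 \<le> 1 + (norm t)\<^sup>2"
    by (rule tendsto_upperbound) simp
  then show ?thesis by simp
qed

text \<open>\<open>coeff_inequality_unit_bound\<close> holds for every \<open>t\<close>. The value
  \<open>t = 0\<close> settles the case of \<open>a 0\<close> on the unit circle; otherwise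
  \<open>t\<close> is optimized.\<close>

lemma wiener_coeff_bound:
  fixes a :: "nat \<Rightarrow> complex"
  assumes sums: "\<And>z. z \<in> ball 0 1 \<Longrightarrow> (\<lambda>k. a k * z ^ k) sums f z"
    and bound: "\<And>z. z \<in> ball 0 1 \<Longrightarrow> norm (f z) \<le> 1"
    and n: "n \<ge> 1"
  shows "norm (a n) \<le> 1 - (norm (a 0))\<^sup>2"
proof -
  note * = coeff_inequality_unit_bound[OF sums bound n]
  define A x where "A = norm (a 0)" and "x = norm (a n)"
  have sq: "A\<^sup>2 + x\<^sup>2 \<le> 1"
    using *[of 0] by (simp add: A_def x_def)
  show ?thesis
  proof (cases "A\<^sup>2 = 1")
    case True
    with sq show ?thesis by (simp add: A_def x_def)
  next
    case False
    then have pos: "1 - A\<^sup>2 > 0"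
      using sq zero_le_power2[of x] by linarith
    \<comment> \<open>\<open>t = u a\<^sub>n cnj(a\<^sub>0)\<close> is the optimal choice of the free parameter.\<close>
    define u where "u = 1 / (1 - A\<^sup>2)"
    have "u > 0" using pos by (simp add: u_def)
    have "complex_of_real A ^ 2 = cnj (a 0) * a 0"
      unfolding A_def by (metis complex_norm_square mult.commute of_real_power)
    then have "a n + of_real u * a n * cnj (a 0) * a 0 = of_real (1 + u * A\<^sup>2) * a n"
      by (simp add: algebra_simps)
    \<comment> \<open>Hence a_n + t a_0 = u a_n for the chosen t.\<close>
    also have "1 + u * A\<^sup>2 = u"
      using pos by (simp add: u_def field_simps)
    finally have "A\<^sup>2 + (u * x)\<^sup>2 \<le> 1 + (u * x * A)\<^sup>2"
      using *[of "of_real u * a n * cnj (a 0)"] \<open>u > 0\<close>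
      by (simp add: norm_mult A_def x_def)
    then have "u * x\<^sup>2 * (u * (1 - A\<^sup>2)) \<le> 1 - A\<^sup>2"
      by (simp add: power_mult_distrib algebra_simps power2_eq_square)
    then have "x\<^sup>2 \<le> (1 - A\<^sup>2)\<^sup>2"
      using pos by (simp add: u_def field_simps power2_eq_square)
    then show ?thesis
      using pos power2_le_imp_le by (simp add: A_def x_def)
  qed
qed

section \<open>The area of the image of a disc\<close>

lemma det_matrix_2:
  fixes F :: "real^2 \<Rightarrow> real^2"
  shows "det (matrix F) = F (axis 1 1) $ 1 * F (axis 2 1) $ 2 - F (axis 2 1) $ 1 * F (axis 1 1) $ 2"
  by (simp add: det_2 matrix_def)

text \<open>
  The area formula is applied to \<open>f\<close> in polar coordinates on the rectangle
  \<open>[0,r] \<times> [0,2\<pi>]\<close>: no injectivity is needed for the inequality, and Fubini then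
  provides the integrals over circles.
\<close>
lemma measure_holomorphic_image_cball_le:
  assumes holo: "f holomorphic_on S" and S: "open S" "cball 0 r \<subseteq> S" and r: "0 \<le> r"
  shows "measure lebesgue (f ` cball 0 r)
    \<le> integral {0..r} (\<lambda>\<rho>. integral {0..2 * pi} (\<lambda>t. (norm (deriv f (\<rho> * cis t)))\<^sup>2 * \<rho>))"
proof -
  let ?Q = "cbox (vector [0, 0]) (vector [r, 2 * pi]) :: (real^2) set"
  let ?p = "\<lambda>v::real^2. complex_of_real (v $ 1) * cis (v $ 2)"
  let ?V = "\<lambda>z. vector [Re z, Im z] :: real^2"
  let ?T = "\<lambda>v::real^2. ?V (f (?p v))"
  \<comment> \<open>The chain rule in polar coordinates: \<open>?p\<close> has partial derivatives
    cis \<theta> and i \<rho> cis \<theta>.\<close>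
  let ?D = "\<lambda>v h::real^2. ?V (deriv f (?p v) * (h $ 1 *\<^sub>R cis (v $ 2) + h $ 2 *\<^sub>R (\<i> * ?p v)))"
  let ?G = "\<lambda>(\<rho>, t). (norm (deriv f (complex_of_real \<rho> * cis t)))\<^sup>2 * \<rho>"
  have pS: "?p v \<in> S" if "v \<in> ?Q" for v
    using that S by (auto simp: mem_box_cart forall_2 norm_mult subset_iff)
  have der: "(?T has_derivative ?D v) (at v within ?Q)" if "v \<in> ?Q" for v
  proof -
    have "(f has_derivative (*) (deriv f (?p v))) (at (?p v))"
      using holomorphic_derivI[OF holo S(1) pS[OF that]] by (simp add: has_field_derivative_def)
    moreover have "(?p has_derivative (\<lambda>h. h $ 1 *\<^sub>R cis (v $ 2) + h $ 2 *\<^sub>R (\<i> * ?p v))) (at v within ?Q)"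
      by (auto intro!: derivative_eq_intros bounded_linear.has_derivative[OF bounded_linear_vec_nth]
          simp: scaleR_conv_of_real fun_eq_iff algebra_simps)
    ultimately have "((\<lambda>v. f (?p v)) has_derivative
        (\<lambda>h. deriv f (?p v) * (h $ 1 *\<^sub>R cis (v $ 2) + h $ 2 *\<^sub>R (\<i> * ?p v)))) (at v within ?Q)"
      by (rule has_derivative_compose[rotated])
    then show ?thesis
      unfolding vector_2_eq_axis by (intro derivative_intros)
  qed
  have cont: "continuous_on (cbox (0, 0) (r, 2 * pi)) ?G"
  proof -
    have "continuous_on S (deriv f)"
      using holo S(1) by (intro holomorphic_on_imp_continuous_on holomorphic_deriv)
    then have "continuous_on (cbox (0, 0) (r, 2 * pi)) (\<lambda>x. deriv f (complex_of_real (fst x) * cis (snd x)))"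
      by (rule continuous_on_compose2)
        (use S(2) in \<open>auto intro!: continuous_intros simp: cbox_Pair_eq norm_mult subset_iff\<close>)
    then show ?thesis
      unfolding case_prod_beta by (intro continuous_intros)
  qed
  have det: "\<bar>det (matrix (?D v))\<bar> = ?G (v $ 1, v $ 2)" if "v \<in> ?Q" for v
  proof -
    \<comment> \<open>The columns of the Jacobian are c and i \<rho> c, orthogonal vectors of
      lengths |c| and \<rho> |c|, so the determinant is \<rho> |c|^2.\<close>
    define c where "c = deriv f (?p v) * cis (v $ 2)"
    have D: "?D v (axis 1 1) = ?V c" "?D v (axis 2 1) = ?V (\<i> * (v $ 1) * c)"
      by (simp_all add: c_def axis_def mult_ac)
    have "det (matrix (?D v)) = (norm c)\<^sup>2 * (v $ 1)"
      unfolding det_matrix_2 D cmod_power2 by (simp add: power2_eq_square algebra_simps)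
    moreover have "v $ 1 \<ge> 0" using that by (simp add: mem_box_cart forall_2)
    ultimately show ?thesis by (simp add: c_def norm_mult)
  qed
  have "(\<lambda>v. ?G (v $ 1, v $ 2)) integrable_on ?Q"
    by (intro integrable_continuous continuous_on_compose2[OF cont])
      (auto intro!: continuous_intros simp: mem_box_cart forall_2 cbox_Pair_eq)
  then have int: "(\<lambda>v. \<bar>det (matrix (?D v))\<bar>) integrable_on ?Q"
    using det by (simp cong: integrable_cong)
  have "f ` cball 0 r = (\<lambda>v. f (?p v)) ` ?Q"
  proof (intro antisym subsetI)
    fix w assume "w \<in> f ` cball 0 r"
    then obtain z where z: "norm z \<le> r" "w = f z" by auto
    let ?v = "vector [norm z, Arg2pi z] :: real^2"
    have "?p ?v = z"
      using Arg2pi_eq[of z] by (simp add: cis_conv_exp)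
    moreover have "?v \<in> ?Q"
      using z Arg2pi[of z] by (simp add: mem_box_cart forall_2)
    ultimately show "w \<in> (\<lambda>v. f (?p v)) ` ?Q"
      using z(2) by (metis (no_types, lifting) image_eqI)
  qed (auto simp: mem_box_cart forall_2 norm_mult)
  then have img: "?V ` f ` cball 0 r = ?T ` ?Q"
    by (simp add: image_image)
  have "compact (f ` cball 0 r)"
    using holo S(2) by (intro compact_continuous_image compact_cball)
      (meson continuous_on_subset holomorphic_on_imp_continuous_on)
  then have "measure lebesgue (f ` cball 0 r) = measure lebesgue (?T ` ?Q)"
    unfolding img[symmetric] by (intro measure_complex_eq_cart2 borel_compact)
  also have "\<dots> \<le> integral ?Q (\<lambda>v. \<bar>det (matrix (?D v))\<bar>)"
    using der int by (intro measure_differentiable_image) auto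
  also have "\<dots> = integral ?Q (\<lambda>v. ?G (v $ 1, v $ 2))"
    using det by (rule integral_cong)
  also have "\<dots> = integral {0..r} (\<lambda>\<rho>. integral {0..2 * pi} (\<lambda>t. ?G (\<rho>, t)))"
    by (rule integral_cart2_eq_iterated[OF cont])
  finally show ?thesis by simp
qed

text \<open>The right-hand side is the value of the infinite series; induction gives the partial sum
  with an explicit remainder, which is nonnegative.\<close>

lemma sum_Suc_squared_power_le:
  fixes x :: real
  assumes x: "0 \<le> x" "x < 1"
  shows "(\<Sum>k<n. (real (Suc k))\<^sup>2 * x ^ k) \<le> (1 + x) / (1 - x) ^ 3"
proof -
  have "(1 - x) ^ 3 * (\<Sum>k<n. (real (Suc k))\<^sup>2 * x ^ k)
      = 1 + x - x ^ n * ((real n)\<^sup>2 * (1 - x)\<^sup>2 + 2 * real n * (1 - x) + 1 + x)"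
    by (induction n) (simp_all add: algebra_simps power2_eq_square power3_eq_cube)
  moreover have "x ^ n * ((real n)\<^sup>2 * (1 - x)\<^sup>2 + 2 * real n * (1 - x) + 1 + x) \<ge> 0"
    using x by simp
  ultimately show ?thesis
    using x by (simp add: pos_le_divide_eq mult.commute)
qed

text \<open>Heuristically the area is at most \<pi> times the sum of n |a_n|^2 r^(2n), and replacing
  each |a_n| by \<open>M\<close> leaves the sum of n x^n = x/(1 - x)^2 at x = r^2. The proof inserts
  \<open>M\<close> on each circle, before integrating over the radius.\<close>

lemma measure_power_series_image_ball_le:
  fixes a :: "nat \<Rightarrow> complex"
  assumes sums: "\<And>z. z \<in> ball 0 1 \<Longrightarrow> (\<lambda>k. a k * z ^ k) sums f z"
    and M: "\<And>n. n \<ge> 1 \<Longrightarrow> norm (a n) \<le> M"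
    and r: "0 \<le> r" "r < 1"
  shows "measure lebesgue (f ` ball 0 r) \<le> pi * M\<^sup>2 * (r\<^sup>2 / (1 - r\<^sup>2)\<^sup>2)"
proof -
  have sm: "summable (\<lambda>k. a k * z ^ k)" if "norm z < 1" for z
    using sums[of z] that by (simp add: sums_iff)
  have der: "(f has_field_derivative (\<Sum>k. diffs a k * z ^ k)) (at z)" if "norm z < 1" for z
  proof (rule has_field_derivative_transform_within_open)
    show "((\<lambda>z. \<Sum>k. a k * z ^ k) has_field_derivative (\<Sum>k. diffs a k * z ^ k)) (at z)"
      using sm that by (rule termdiffs_strong')
    show "(\<Sum>k. a k * w ^ k) = f w" if "w \<in> ball 0 1" for w
      using sums[OF that] by (simp add: sums_iff)
  qed (use that in auto)
  have deriv: "deriv f z = (\<Sum>k. diffs a k * z ^ k)" if "norm z < 1" for z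
    using der[OF that] by (rule DERIV_imp_deriv)
  have holo: "f holomorphic_on ball 0 1"
    unfolding holomorphic_on_open[OF open_ball]
  proof (intro ballI exI)
    fix z :: complex assume "z \<in> ball 0 1"
    then show "(f has_field_derivative (\<Sum>k. diffs a k * z ^ k)) (at z)" by (intro der) simp
  qed
  have inner: "integral {0..2 * pi} (\<lambda>t. (norm (deriv f (\<rho> * cis t)))\<^sup>2 * \<rho>)
      \<le> pi * M\<^sup>2 * (2 * \<rho> * (1 + \<rho>\<^sup>2) / (1 - \<rho>\<^sup>2) ^ 3)" if \<rho>: "0 \<le> \<rho>" "\<rho> \<le> r" for \<rho>
  proof -
    define c where "c k = diffs a k * \<rho> ^ k" for k
    have \<rho>1: "\<rho> < 1" using \<rho> r by simp
    have x1: "\<rho>\<^sup>2 < 1" using \<rho> \<rho>1 by (simp add: power_less_one_iff)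
    have "summable (\<lambda>k. diffs a k * of_real ((1 + \<rho>) / 2) ^ k)"
      using \<rho> \<rho>1 by (intro termdiff_converges[of _ 1] sm) (auto simp del: of_real_divide of_real_add)
    then have smc: "summable (\<lambda>k. norm (c k))"
      using powser_insidea[of "diffs a" "of_real ((1 + \<rho>) / 2)" "of_real \<rho>"] \<rho> \<rho>1
      by (simp add: c_def norm_mult norm_power del: of_real_divide of_real_add)
    have "deriv f (\<rho> * cis t) = (\<Sum>k. c k * cis (k * t))" for t :: real
      using \<rho> \<rho>1 by (simp add: deriv norm_mult c_def power_mult_distrib Complex.DeMoivre mult_ac)
    then have "((\<lambda>t. (norm (deriv f (\<rho> * cis t)))\<^sup>2 * \<rho>) has_integral 2 * pi * (\<Sum>k. (norm (c k))\<^sup>2) * \<rho>) {0..2 * pi}"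
      using has_integral_mult_left[OF parseval_cis_series[OF smc]] by simp
    then have "integral {0..2 * pi} (\<lambda>t. (norm (deriv f (\<rho> * cis t)))\<^sup>2 * \<rho>) = 2 * pi * (\<Sum>k. (norm (c k))\<^sup>2) * \<rho>"
      by (rule integral_unique)
    also have "\<dots> \<le> 2 * pi * (M\<^sup>2 * ((1 + \<rho>\<^sup>2) / (1 - \<rho>\<^sup>2) ^ 3)) * \<rho>"
    proof (intro mult_left_mono mult_right_mono suminf_le_const summable_norm_squared smc)
      fix n
      have "(\<Sum>k<n. (norm (c k))\<^sup>2) \<le> (\<Sum>k<n. M\<^sup>2 * ((real (Suc k))\<^sup>2 * (\<rho>\<^sup>2) ^ k))"
      proof (rule sum_mono)
        fix k
        \<comment> \<open>\<open>diffs a k\<close> involves \<open>a (Suc k)\<close>, so the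
          constant coefficient, which \<open>M\<close> need not bound, never enters.\<close>
        have "(norm (c k))\<^sup>2 = (norm (a (Suc k)))\<^sup>2 * ((real (Suc k))\<^sup>2 * (\<rho>\<^sup>2) ^ k)"
          unfolding c_def diffs_def using \<rho>
          by (simp add: norm_mult norm_power power_mult_distrib mult_ac flip: power_mult del: of_nat_Suc)
        also have "\<dots> \<le> M\<^sup>2 * ((real (Suc k))\<^sup>2 * (\<rho>\<^sup>2) ^ k)"
          using M[of "Suc k"] by (intro mult_right_mono power_mono) auto
        finally show "(norm (c k))\<^sup>2 \<le> M\<^sup>2 * ((real (Suc k))\<^sup>2 * (\<rho>\<^sup>2) ^ k)" .
      qed
      also have "\<dots> = M\<^sup>2 * (\<Sum>k<n. (real (Suc k))\<^sup>2 * (\<rho>\<^sup>2) ^ k)"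
        by (simp add: sum_distrib_left)
      also have "\<dots> \<le> M\<^sup>2 * ((1 + \<rho>\<^sup>2) / (1 - \<rho>\<^sup>2) ^ 3)"
        using sum_Suc_squared_power_le[of "\<rho>\<^sup>2" n] x1 by (intro mult_left_mono) auto
      finally show "(\<Sum>k<n. (norm (c k))\<^sup>2) \<le> M\<^sup>2 * ((1 + \<rho>\<^sup>2) / (1 - \<rho>\<^sup>2) ^ 3)" .
    qed (use \<rho> in auto)
    finally show ?thesis by (simp add: algebra_simps)
  qed
  \<comment> \<open>The bound on the circles is the derivative in \<rho> of \<pi> M^2 \<rho>^2/(1 -
    \<rho>^2)^2, which vanishes at 0.\<close>
  have outer: "((\<lambda>\<rho>. pi * M\<^sup>2 * (2 * \<rho> * (1 + \<rho>\<^sup>2) / (1 - \<rho>\<^sup>2) ^ 3)) has_integral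
      pi * M\<^sup>2 * (r\<^sup>2 / (1 - r\<^sup>2)\<^sup>2) - pi * M\<^sup>2 * (0\<^sup>2 / (1 - 0\<^sup>2)\<^sup>2)) {0..r}"
  proof (rule fundamental_theorem_of_calculus[OF r(1)])
    fix \<rho> assume "\<rho> \<in> {0..r}"
    then have "1 - \<rho>\<^sup>2 \<noteq> 0" using r by (simp add: power2_eq_1_iff)
    then have "((\<lambda>\<rho>. pi * M\<^sup>2 * (\<rho>\<^sup>2 / (1 - \<rho>\<^sup>2)\<^sup>2)) has_real_derivative
        pi * M\<^sup>2 * (2 * \<rho> * (1 + \<rho>\<^sup>2) / (1 - \<rho>\<^sup>2) ^ 3)) (at \<rho> within {0..r})"
      by (auto intro!: derivative_eq_intros simp: divide_simps) 
        (simp add: algebra_simps power2_eq_square power3_eq_cube power4_eq_xxxx)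
    then show "((\<lambda>\<rho>. pi * M\<^sup>2 * (\<rho>\<^sup>2 / (1 - \<rho>\<^sup>2)\<^sup>2)) has_vector_derivative
        pi * M\<^sup>2 * (2 * \<rho> * (1 + \<rho>\<^sup>2) / (1 - \<rho>\<^sup>2) ^ 3)) (at \<rho> within {0..r})"
      by (simp add: has_real_derivative_iff_has_vector_derivative)
  qed
  have cpt: "compact (f ` cball 0 r)"
    using holo r by (intro compact_continuous_image compact_cball)
      (auto intro!: continuous_on_subset[OF holomorphic_on_imp_continuous_on])
  \<comment> \<open>The area formula is stated for closed discs. For the open disc, a set that is
    not measurable would have \<open>measure\<close> 0 by convention.\<close>
  have "measure lebesgue (f ` ball 0 r) \<le> measure lebesgue (f ` cball 0 r)"
  proof (cases "f ` ball 0 r \<in> sets lebesgue")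
    case True
    then show ?thesis
      using cpt by (intro measure_mono_fmeasurable image_mono ball_subset_cball lmeasurable_compact)
  qed (simp add: measure_notin_sets)
  also have "\<dots> \<le> integral {0..r} (\<lambda>\<rho>. integral {0..2 * pi} (\<lambda>t. (norm (deriv f (\<rho> * cis t)))\<^sup>2 * \<rho>))"
    using holo r by (intro measure_holomorphic_image_cball_le[where S = "ball 0 1"]) auto
  also have "\<dots> \<le> pi * M\<^sup>2 * (r\<^sup>2 / (1 - r\<^sup>2)\<^sup>2)"
  proof -
    have "continuous_on (ball 0 1) (deriv f)"
      using holo by (intro holomorphic_on_imp_continuous_on holomorphic_deriv) auto
    then have "continuous_on (cbox (0, 0) (r, 2 * pi)) (\<lambda>x. deriv f (complex_of_real (fst x) * cis (snd x)))"
      by (rule continuous_on_compose2)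
        (use r in \<open>auto intro!: continuous_intros simp: cbox_Pair_eq norm_mult\<close>)
    then have "continuous_on (cbox (0, 0) (r, 2 * pi)) (\<lambda>x. (norm (deriv f (complex_of_real (fst x) * cis (snd x))))\<^sup>2 * fst x)"
      by (intro continuous_intros)
    from integral_integrable_2dim[OF this]
    have "(\<lambda>\<rho>. integral {0..2 * pi} (\<lambda>t. (norm (deriv f (\<rho> * cis t)))\<^sup>2 * \<rho>)) integrable_on {0..r}"
      by (simp add: cbox_interval)
    then show ?thesis
      using has_integral_le[OF integrable_integral outer] inner by auto
  qed
  finally show ?thesis .
qed

section \<open>Nonconstant functions and the supremum \<open>bohr_lambda\<close>\<close>

text \<open>Replacing the constant term by 1 turns the sum into 1, and Wiener's bound with leading
  coefficient 1 forces every later coefficient to vanish.\<close>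

lemma power_series_const_coeff_eq_0:
  fixes a :: "nat \<Rightarrow> complex"
  assumes sums: "\<And>z. z \<in> ball 0 1 \<Longrightarrow> (\<lambda>k. a k * z ^ k) sums c" and n: "n \<ge> 1"
  shows "a n = 0"
proof -
  define b where "b = a(0 := 1)"
  have "a 0 = c"
    using sums[of 0] powser_sums_zero_iff[of a c] by simp
  have "norm (b n) \<le> 1 - (norm (b 0))\<^sup>2"
  proof (rule wiener_coeff_bound[OF _ _ n])
    fix z :: complex assume "z \<in> ball 0 1"
    have "(\<lambda>k. b k * z ^ k) = (\<lambda>k. a k * z ^ k + (if k = 0 then 1 - c else 0))"
      by (auto simp: b_def \<open>a 0 = c\<close>)
    then show "(\<lambda>k. b k * z ^ k) sums 1"
      using sums_add[OF sums[OF \<open>z \<in> ball 0 1\<close>] sums_single[of 0 "\<lambda>_. 1 - c"]] by simp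
  qed simp
  then show ?thesis using n by (simp add: b_def)
qed

lemma bclass_norm_le: "f \<in> bclass \<Omega> \<Longrightarrow> z \<in> \<Omega> \<Longrightarrow> norm (f z) \<le> 1"
  by (auto simp: bclass_def image_subset_iff)

text \<open>The point is that the supremum is one of a set bounded above: Wiener's bound makes every
  ratio at most 1.\<close>

lemma bohr_lambda_upper:
  assumes ball: "ball 0 1 \<subseteq> \<Omega>" and f: "f \<in> bclass \<Omega>"
    and nonconst: "\<not> (\<exists>c. \<forall>z\<in>\<Omega>. f z = c)"
    and sums: "\<forall>z\<in>ball 0 1. (\<lambda>k. a k * z ^ k) sums f z" and n: "n \<ge> 1"
  shows "norm (a n) / (1 - (norm (a 0))\<^sup>2) \<le> bohr_lambda \<Omega>"
  unfolding bohr_lambda_def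
proof (rule cSup_upper)
  show "bdd_above {norm (a n) / (1 - (norm (a 0))\<^sup>2) | n a f.
      n \<ge> 1 \<and> f \<in> bclass \<Omega> \<and> \<not> (\<exists>c. \<forall>z\<in>\<Omega>. f z = c) \<and>
      (\<forall>z\<in>ball 0 1. (\<lambda>k. a k * z ^ k) sums f z)}"
  proof (rule bdd_aboveI[where M = 1], clarify)
    fix n :: nat and a f
    assume n: "1 \<le> n" and f: "f \<in> bclass \<Omega>"
      and sums: "\<forall>z\<in>ball 0 1. (\<lambda>k. a k * z ^ k) sums f z"
    have le: "norm (a n) \<le> 1 - (norm (a 0))\<^sup>2"
      by (rule wiener_coeff_bound[OF _ _ n, of _ f]) (use sums ball bclass_norm_le[OF f] in auto)
    then have "0 \<le> 1 - (norm (a 0))\<^sup>2"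
      using norm_ge_zero[of "a n"] by linarith
    \<comment> \<open>If the denominator is 0, the quotient is 0 by convention.\<close>
    then show "norm (a n) / (1 - (norm (a 0))\<^sup>2) \<le> 1"
      using le by (auto simp: divide_le_eq_1)
  qed
qed (use assms in blast)

text \<open>A Riemann map of \<Omega> onto the disc is a nonconstant member of the class, so the
  supremum dominates a nonnegative ratio. For the whole plane, Liouville's theorem would empty the
  set of ratios.\<close>

lemma bohr_lambda_nonneg:
  assumes "open \<Omega>" and "simply_connected \<Omega>" and ball: "ball 0 1 \<subseteq> \<Omega>" and "\<Omega> \<noteq> UNIV"
  shows "bohr_lambda \<Omega> \<ge> 0"
proof -
  have "0 \<in> \<Omega>" "1 / 2 \<in> \<Omega>" using ball by (auto simp: subset_iff norm_divide)
  then obtain f g where f: "f holomorphic_on \<Omega>" "\<And>z. z \<in> \<Omega> \<Longrightarrow> f z \<in> ball 0 1 \<and> g (f z) = z"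
    using simply_connected_eq_biholomorphic_to_disc[OF \<open>open \<Omega>\<close>] assms by (metis empty_iff)
  define a where "a n = (deriv ^^ n) f 0 / fact n" for n
  have fb: "f \<in> bclass \<Omega>"
    using f by (fastforce simp: bclass_def)
  have nonconst: "\<not> (\<exists>c. \<forall>z\<in>\<Omega>. f z = c)"
    using f(2)[OF \<open>0 \<in> \<Omega>\<close>] f(2)[OF \<open>1 / 2 \<in> \<Omega>\<close>] \<open>0 \<in> \<Omega>\<close> \<open>1 / 2 \<in> \<Omega>\<close> by force
  have sums: "\<forall>z\<in>ball 0 1. (\<lambda>k. a k * z ^ k) sums f z"
    using holomorphic_power_series[OF holomorphic_on_subset[OF f(1) ball]] by (simp add: a_def)
  have "norm (f 0) < 1" using f(2)[OF \<open>0 \<in> \<Omega>\<close>] by simp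
  then have "0 \<le> norm (a 1) / (1 - (norm (a 0))\<^sup>2)"
    by (intro divide_nonneg_nonneg) (simp_all add: a_def power_le_one)
  also have "\<dots> \<le> bohr_lambda \<Omega>"
    by (rule bohr_lambda_upper[OF ball fb nonconst sums]) simp
  finally show ?thesis .
qed

section \<open>The inequality up to the radius 1/(1 + 2 \<lambda>)\<close>

text \<open>Both left-hand sides increase with \<open>r\<close> and reach the stated constants at r
  = 1/(1 + 2 l).\<close>

lemma bohr_radius_estimates:
  fixes l r :: real
  assumes l: "0 < l" and r: "0 \<le> r" "r \<le> 1 / (1 + 2 * l)"
  shows "l * (r / (1 - r)) \<le> 1 / 2" and "l * ((1 + l) / (1 + 2 * l)) * (r / (1 - r\<^sup>2)) \<le> 1 / 4"
proof -
  let ?s = "1 + 2 * l"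
  have sr: "?s * r \<le> 1" using l r(2) by (simp add: field_simps)
  have "1 / ?s < 1" using l by simp
  then have r1: "r < 1" using r by linarith
  then show "l * (r / (1 - r)) \<le> 1 / 2"
    using sr by (simp add: field_simps)
  \<comment> \<open>The product equals s (1 - r^2) - (s^2 - 1) r, and s^2 - 1 = 4 l (1 + l).\<close>
  have "(1 - ?s * r) * (?s + r) \<ge> 0"
    using sr r l by (intro mult_nonneg_nonneg) auto
  then have "4 * l * (1 + l) * r \<le> ?s * (1 - r\<^sup>2)"
    by (simp add: algebra_simps power2_eq_square)
  moreover have "r\<^sup>2 < 1" using r r1 by (simp add: power_less_one_iff)
  ultimately show "l * ((1 + l) / ?s) * (r / (1 - r\<^sup>2)) \<le> 1 / 4"
    using l by (simp add: divide_simps)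
qed

theorem theorem3:
  fixes \<Omega> :: "complex set" and f :: "complex \<Rightarrow> complex" and a :: "nat \<Rightarrow> complex" and r :: real
  assumes "open \<Omega>" and "connected \<Omega>" and "simply_connected \<Omega>"
    and "ball 0 1 \<subseteq> \<Omega>"
    and "f \<in> bclass \<Omega>"
    and "\<forall>z\<in>ball 0 1. (\<lambda>n. a n * z ^ n) sums f z"
    and "0 \<le> r" and "r \<le> 1 / (1 + 2 * bohr_lambda \<Omega>)"
  shows "(\<Sum>n. norm (a n) * r ^ n)
          + 2 * ((1 + bohr_lambda \<Omega>) / (1 + 2 * bohr_lambda \<Omega>))\<^sup>2
              * measure lebesgue (f ` ball 0 r) / pi \<le> 1"
proof (cases "\<exists>n\<ge>1. a n \<noteq> 0")
  \<comment> \<open>Constant functions are excluded from the supremum, so their coefficients are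
    handled directly: the image of the disc is at most a point.\<close>
  case False
  then have a0: "a n = 0" if "n \<ge> 1" for n using that by blast
  have eq: "f z = a 0" if "z \<in> ball 0 1" for z
  proof -
    have "(\<lambda>n. a n * z ^ n) sums a 0"
      using sums_finite[of "{0}" "\<lambda>n. a n * z ^ n"] a0 by simp
    then show ?thesis
      using assms(6) that sums_unique2 by blast
  qed
  have "f z = a 0" if "z \<in> ball 0 r" for z
  proof (cases "\<Omega> = UNIV")
    \<comment> \<open>Here \<open>bohr_lambda \<Omega>\<close> is the supremum of the empty set, an unspecified real,
      so that \<open>r\<close> may exceed 1.\<close>
    case True
    have "f holomorphic_on UNIV" "bounded (range f)"
      using assms(5) True by (auto simp: bclass_def intro: bounded_subset[OF bounded_cball])
    then obtain c where "\<And>z. f z = c"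
      using Liouville_theorem by (metis UNIV_I constant_on_def)
    then show ?thesis
      using eq[of 0] by simp
  next
    case False
    then have "1 / (1 + 2 * bohr_lambda \<Omega>) \<le> 1"
      using bohr_lambda_nonneg[OF assms(1,3,4)] by simp
    then show ?thesis
      using that assms(8) by (intro eq) auto
  qed
  then have "f ` ball 0 r \<subseteq> {a 0}" by auto
  then have "measure lebesgue (f ` ball 0 r) = 0"
    by (intro negligible_imp_measure0 negligible_subset[OF negligible_sing])
  moreover have "(\<Sum>n. norm (a n) * r ^ n) = norm (a 0)"
    using suminf_finite[of "{0}" "\<lambda>n. norm (a n) * r ^ n"] a0 by simp
  moreover have "norm (a 0) \<le> 1"
    using eq[of 0] assms(4) bclass_norm_le[OF assms(5), of 0] by (simp add: subset_iff)
  ultimately show ?thesis by simp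
next
  case True
  then obtain m where m: "m \<ge> 1" "a m \<noteq> 0" by blast
  define l A where "l = bohr_lambda \<Omega>" and "A = norm (a 0)"
  define M where "M = l * (1 - A\<^sup>2)"
  have nonconst: "\<not> (\<exists>c. \<forall>z\<in>\<Omega>. f z = c)"
    using power_series_const_coeff_eq_0[of a _ m] m assms(4,6) by (metis subsetD)
  \<comment> \<open>A nonzero later coefficient forces A < 1, so the ratios have a positive
    denominator and l > 0.\<close>
  have "norm (a m) \<le> 1 - A\<^sup>2"
    unfolding A_def
    by (rule wiener_coeff_bound[OF _ _ m(1), of _ f]) (use assms(4,6) bclass_norm_le[OF assms(5)] in auto)
  then have pos: "1 - A\<^sup>2 > 0" using m(2) by (smt (verit) zero_less_norm_iff)
  have ratio: "norm (a n) / (1 - A\<^sup>2) \<le> l" if "n \<ge> 1" for n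
    unfolding A_def l_def by (rule bohr_lambda_upper[OF assms(4,5) nonconst assms(6) that])
  have "0 < norm (a m) / (1 - A\<^sup>2)" using pos m by simp
  then have l: "0 < l" using ratio[OF m(1)] by linarith
  have bound: "norm (a n) \<le> M" if "n \<ge> 1" for n
    using ratio[OF that] pos by (simp add: M_def pos_divide_le_eq)
  have r: "0 \<le> r" "r \<le> 1 / (1 + 2 * l)" using assms(7,8) by (simp_all add: l_def)
  have "1 / (1 + 2 * l) < 1" using l by simp
  then have r1: "r < 1" using r by linarith
  have "A\<^sup>2 < 1\<^sup>2" using pos by simp
  then have A: "0 \<le> A" "A < 1" using power_less_imp_less_base[of A 2 1] by (simp_all add: A_def)

  have series: "(\<Sum>n. norm (a n) * r ^ n) \<le> A + (1 - A\<^sup>2) / 2"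
  proof -
    have geo: "(\<lambda>n. M * r * r ^ n) sums (M * r * (1 / (1 - r)))"
      using r r1 by (intro sums_mult geometric_sums) simp
    have le: "norm (a (Suc n)) * r ^ Suc n \<le> M * r * r ^ n" for n
      using mult_right_mono[OF bound[of "Suc n"], of "r ^ Suc n"] r by (simp add: mult_ac)
    have sm: "summable (\<lambda>n. norm (a (Suc n)) * r ^ Suc n)"
      using r by (intro summable_comparison_test'[OF sums_summable[OF geo]]) (use le in \<open>auto simp: abs_mult\<close>)
    then have "summable (\<lambda>n. norm (a n) * r ^ n)"
      by (subst (asm) summable_Suc_iff)
    from suminf_split_head[OF this] have "(\<Sum>n. norm (a n) * r ^ n) = A + (\<Sum>n. norm (a (Suc n)) * r ^ Suc n)"
      by (simp add: A_def)
    also have "(\<Sum>n. norm (a (Suc n)) * r ^ Suc n) \<le> M * r * (1 / (1 - r))"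
      using suminf_le[OF le sm sums_summable[OF geo]] sums_unique[OF geo] by simp
    also have "\<dots> = (1 - A\<^sup>2) * (l * (r / (1 - r)))"
      by (simp add: M_def)
    also have "\<dots> \<le> (1 - A\<^sup>2) * (1 / 2)"
      using pos bohr_radius_estimates(1)[OF l r] by (intro mult_left_mono) auto
    finally show ?thesis by simp
  qed
  have "2 * ((1 + l) / (1 + 2 * l))\<^sup>2 * measure lebesgue (f ` ball 0 r) / pi
      \<le> 2 * ((1 + l) / (1 + 2 * l))\<^sup>2 * (pi * M\<^sup>2 * (r\<^sup>2 / (1 - r\<^sup>2)\<^sup>2)) / pi"
    using bound r r1 assms(6)
    by (intro divide_right_mono mult_left_mono measure_power_series_image_ball_le[of a f M]) auto
  \<comment> \<open>The weight ((1 + l)/(1 + 2 l))^2 is absorbed into the square so that the second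
    estimate of \<open>bohr_radius_estimates\<close> applies.\<close>
  also have "\<dots> = 2 * ((1 - A\<^sup>2) * (l * ((1 + l) / (1 + 2 * l)) * (r / (1 - r\<^sup>2))))\<^sup>2"
    by (simp add: M_def power_mult_distrib power_divide)
  also have "\<dots> \<le> 2 * ((1 - A\<^sup>2) * (1 / 4))\<^sup>2"
    using pos l r r1 bohr_radius_estimates(2)[OF l r]
    by (intro mult_left_mono power_mono mult_nonneg_nonneg divide_nonneg_nonneg) (auto simp: power_le_one)
  also have "\<dots> = (1 - A\<^sup>2)\<^sup>2 / 8"
    by (simp add: power_mult_distrib power_divide)
  finally have area: "2 * ((1 + l) / (1 + 2 * l))\<^sup>2 * measure lebesgue (f ` ball 0 r) / pi \<le> (1 - A\<^sup>2)\<^sup>2 / 8" .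
  \<comment> \<open>This is 8 times the difference between 1 and the sum of the two bounds.\<close>
  have "(1 - A)\<^sup>2 * ((1 - A) * (3 + A)) \<ge> 0"
    using A by simp
  then have "A + (1 - A\<^sup>2) / 2 + (1 - A\<^sup>2)\<^sup>2 / 8 \<le> 1"
    by (simp add: field_simps power2_eq_square)
  then show ?thesis
    using series area unfolding l_def by linarith
qed

end
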